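(* Let $r\in[0,\infty)$, let $p\in(0,\infty)$, let $u\in\mathbb{S}^{n-1}$, let $H=\{x\in\mathbb{R}^n:\langle x,u\rangle=0\}$, and let $K\subset\mathbb{R}^n$ be a compact set with non-empty interior. Let $f:\mathbb{R}\to\mathbb{R}_{\geq0}$, $f(t)=\mathrm{vol}_{n-1}\bigl(K\cap(tu+H)\bigr)$, and assume $f$ is $p$-concave. Assume that $\mathrm{g}_r=0$, where $\mathrm{g}_r$ is the $r$-powered centroid of $K$ in direction $u$ defined in the context. Let $K^-=K\cap\{x\in\mathbb{R}^n:\langle x,u\rangle\leq 0\}$. Then, if $r\geq1$, \[\frac{\mathrm{vol}(K^-)}{\mathrm{vol}(K)}\geq\left(\frac{p+1}{2p+r}\right)^{(p+1)/p},\] whereas if $0\leq r\leq 1$, \[\frac{\mathrm{vol}(K^-)}{\mathrm{vol}(K)}\geq\left(\frac{p+r}{2p+r}\right)^{(p+1)/p}.\]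
   Context: $\mathrm{vol}_k$ denotes $k$-dimensional Lebesgue measure, $\mathrm{vol}=\mathrm{vol}_n$. A function $\varphi:\mathbb{R}^m\to\mathbb{R}_{\geq0}$ is $p$-concave ($p>0$) if $\varphi((1-\lambda)x+\lambda y)\geq((1-\lambda)\varphi(x)^p+\lambda\varphi(y)^p)^{1/p}$ for all $x,y$ with $\varphi(x)\varphi(y)>0$ and all $\lambda\in(0,1)$; equivalently $\varphi^p$ is concave on its support. Under the hypotheses, $\{t:f(t)>0\}$ is an interval $(a,b)$ (up to endpoints), and $[a,b]$ denotes the support of $f$. For $r>0$ the $r$-powered centroid (in direction $u$) is $\mathrm{g}_r=\frac{\int_a^b t f(t)^r\,dt}{\int_a^b f(t)^r\,dt}$; for $r=0$, $\mathrm{g}_0=\frac{a+b}{2}$ (the midpoint of $K$ in direction $u$, corresponding to $f^0$ being the indicator of $[a,b]$). The hypothesis "$\mathrm{g}_r=0$" means the point $\mathrm{g}_r\cdot u$ is the origin. *)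

theory Defs
  imports "HOL-Analysis.Analysis"
begin

text \<open>(n-1)-dimensional volume of the section of K by the hyperplane
  t u + H, H = u-orthogonal complement (u a unit vector). Since no Hausdorff
  measure is available, vol_{n-1}(S) of a set S lying in a hyperplane orthogonal
  to the unit vector u is computed as the n-dimensional Lebesgue measure of the
  right prism S + [0,1] u of height 1.\<close>
definition section_vol :: "'a::euclidean_space set \<Rightarrow> 'a \<Rightarrow> real \<Rightarrow> real" where
  "section_vol K u t =
     measure lebesgue ((\<lambda>(x, h). x + h *\<^sub>R u) ` ((K \<inter> {x. x \<bullet> u = t}) \<times> {0..1::real}))"

definition p_concave :: "(real \<Rightarrow> real) \<Rightarrow> real \<Rightarrow> bool" where
  "p_concave \<phi> p \<longleftrightarrow>
     (\<forall>x y l. \<phi> x * \<phi> y > 0 \<longrightarrow> 0 < l \<longrightarrow> l < 1 \<longrightarrow>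
        \<phi> ((1 - l) * x + l * y) \<ge> ((1 - l) * \<phi> x powr p + l * \<phi> y powr p) powr (1 / p))"

definition supp_lo :: "(real \<Rightarrow> real) \<Rightarrow> real" where
  "supp_lo f = Inf {t. f t > 0}"

definition supp_hi :: "(real \<Rightarrow> real) \<Rightarrow> real" where
  "supp_hi f = Sup {t. f t > 0}"

definition powered_centroid :: "(real \<Rightarrow> real) \<Rightarrow> real \<Rightarrow> real" where
  "powered_centroid f r =
     (if r = 0 then (supp_lo f + supp_hi f) / 2
      else (LINT t:{supp_lo f..supp_hi f}|lborel. t * f t powr r) /
           (LINT t:{supp_lo f..supp_hi f}|lborel. f t powr r))"

end

theory Submission
  imports Defs
begin

text \<open>Let \<open>F\<close> be the distribution function of the section function \<open>f\<close>, \<open>V\<close> its total mass and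
  \<open>\<theta> = p / (p + 1)\<close>. Concavity of \<open>f powr p\<close> makes \<open>f powr (p + 1)\<close> a concave function of \<open>F\<close>; hence
  \<open>f powr (p + 1) / F\<close> decreases, \<open>f powr (p + 1) / (V - F)\<close> increases and \<open>F powr \<theta>\<close> is concave.
  Jensen's inequality for the weight \<open>f powr r\<close>, whose centroid is \<open>0\<close>, bounds \<open>F 0 powr \<theta>\<close>
  from below by the mean of \<open>F powr \<theta>\<close>. That mean is estimated by Chebyshev's inequality: with
  \<open>\<beta> = (r - 1) / (p + 1)\<close>, the weight \<open>f powr r\<close> is an increasing function times \<open>f * F powr \<beta>\<close>
  (if \<open>r \<le> 1\<close>) or \<open>f * (V - F) powr \<beta>\<close> (if \<open>r \<ge> 1\<close>), and for these two weights the mean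
  is an integral in \<open>y = F / V\<close> alone, evaluated exactly in the first case and bounded using
  \<open>y \<le> y powr \<theta>\<close> in the second.\<close>

section \<open>Volumes of sections\<close>

text \<open>As \<open>u\<close> is a unit vector, \<open>y \<bullet> u - t\<close> recovers the
  height \<open>h\<close> of a prism point \<open>y\<close>. The image thus becomes a condition on
  the pair \<open>(t, y)\<close>, the form suited to Fubini.\<close>

lemma section_vol_prism:
  fixes K :: "'a::euclidean_space set"
  assumes "norm u = 1"
  shows "(\<lambda>(x, h). x + h *\<^sub>R u) ` ((K \<inter> {x. x \<bullet> u = t}) \<times> {0..1::real}) =
    {y. y \<bullet> u - t \<in> {0..1} \<and> y - (y \<bullet> u - t) *\<^sub>R u \<in> K}"
proof -
  have uu: "u \<bullet> u = 1" using assms by (simp add: dot_square_norm)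
  show ?thesis
  proof (intro set_eqI iffI)
    fix y assume "y \<in> (\<lambda>(x, h). x + h *\<^sub>R u) ` ((K \<inter> {x. x \<bullet> u = t}) \<times> {0..1::real})"
    then show "y \<in> {y. y \<bullet> u - t \<in> {0..1} \<and> y - (y \<bullet> u - t) *\<^sub>R u \<in> K}"
      by (auto simp: inner_add_left uu)
  next
    fix y assume "y \<in> {y. y \<bullet> u - t \<in> {0..1} \<and> y - (y \<bullet> u - t) *\<^sub>R u \<in> K}"
    then have "(y - (y \<bullet> u - t) *\<^sub>R u, y \<bullet> u - t) \<in> (K \<inter> {x. x \<bullet> u = t}) \<times> {0..1::real}"
      by (auto simp: inner_diff_left uu)
    then show "y \<in> (\<lambda>(x, h). x + h *\<^sub>R u) ` ((K \<inter> {x. x \<bullet> u = t}) \<times> {0..1::real})"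
      by (rule rev_image_eqI) simp
  qed
qed

lemma compact_prism:
  assumes "compact K"
  shows "compact ((\<lambda>(x, h). x + h *\<^sub>R u) ` ((K \<inter> {x. x \<bullet> u = t}) \<times> {0..1::real}))"
  by (intro compact_continuous_image compact_Times compact_Int_closed assms)
    (auto intro!: continuous_intros closed_Collect_eq simp: case_prod_unfold)

text \<open>Compactness makes the prism a Borel set of finite measure, which allows the passage from
  the real-valued measure to \<open>emeasure lborel\<close>, where Tonelli's theorem
  applies.\<close>

lemma emeasure_prism:
  fixes K :: "'a::euclidean_space set"
  assumes "norm u = 1" "compact K"
  shows "ennreal (section_vol K u t) =
    emeasure lborel {y. y \<bullet> u - t \<in> {0..1} \<and> y - (y \<bullet> u - t) *\<^sub>R u \<in> K}" (is "_ = emeasure lborel ?P")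
proof -
  have c: "compact ?P"
    using compact_prism[OF assms(2), of u t] unfolding section_vol_prism[OF assms(1)] .
  then have b: "?P \<in> sets borel" by (rule borel_compact)
  have "section_vol K u t = measure lborel ?P"
    unfolding section_vol_def section_vol_prism[OF assms(1)] using b by simp
  moreover have "emeasure lborel ?P < \<infinity>"
    using c by (rule emeasure_compact_finite)
  ultimately show ?thesis by (simp add: emeasure_eq_ennreal_measure less_top)
qed

text \<open>Joint measurability in \<open>(t, y)\<close>: the prisms over all heights together form
  a closed set, cut out by closed conditions on continuous functions.\<close>

lemma borel_prisms:
  fixes K :: "'a::euclidean_space set"
  assumes "compact K"
  shows "{z :: real \<times> 'a. snd z \<bullet> u - fst z \<in> {0..1} \<and> snd z - (snd z \<bullet> u - fst z) *\<^sub>R u \<in> K}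
    \<in> sets (lborel \<Otimes>\<^sub>M lborel)" (is "?S \<in> _")
proof -
  have "closed K" using assms by (rule compact_imp_closed)
  then have "closed ?S"
    by (intro closed_Collect_conj)
      (auto intro!: continuous_intros closed_vimage closed_Collect_conj closed_Collect_le simp: vimage_def[symmetric])
  then have "?S \<in> sets borel" by (rule borel_closed)
  then show ?thesis by (simp only: lborel_prod sets_lborel)
qed

lemma section_vol_measurable:
  fixes K :: "'a::euclidean_space set"
  assumes "norm u = 1" "compact K"
  shows "section_vol K u \<in> borel_measurable borel"
proof -
  have "(\<lambda>t. emeasure lborel {y. y \<bullet> u - t \<in> {0..1} \<and> y - (y \<bullet> u - t) *\<^sub>R u \<in> K})
     \<in> borel_measurable lborel"
    using lborel.measurable_emeasure_Pair[OF borel_prisms[OF assms(2), of u]] by (simp add: vimage_def)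
  then have "(\<lambda>t. enn2real (ennreal (section_vol K u t))) \<in> borel_measurable borel"
    unfolding emeasure_prism[OF assms] by simp
  moreover have "enn2real (ennreal (section_vol K u t)) = section_vol K u t" for t
    by (simp add: section_vol_def)
  ultimately show ?thesis by simp
qed

text \<open>Writing a point of the prism over the section at height \<open>t\<close> as \<open>y = x + h u\<close> and integrating
  first over \<open>t = y \<bullet> u - h\<close> replaces the rotation that a Fubini decomposition along \<open>u\<close> would need
  by translation invariance.\<close>
lemma nn_integral_section_vol:
  fixes K :: "'a::euclidean_space set"
  assumes u: "norm u = 1" and K: "compact K" and T: "T \<in> sets borel"
  shows "(\<integral>\<^sup>+t. ennreal (section_vol K u t) * indicator T t \<partial>lborel)
    = emeasure lborel (K \<inter> {x. x \<bullet> u \<in> T})"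
proof -
  have uu: "u \<bullet> u = 1" using u by (simp add: dot_square_norm)
  let ?P = "\<lambda>t. {y. y \<bullet> u - t \<in> {0..1} \<and> y - (y \<bullet> u - t) *\<^sub>R u \<in> K}"
  let ?S = "{z :: real \<times> 'a. snd z \<bullet> u - fst z \<in> {0..1} \<and> snd z - (snd z \<bullet> u - fst z) *\<^sub>R u \<in> K}"
  let ?A = "K \<inter> {x. x \<bullet> u \<in> T}"
  have [measurable]: "T \<in> sets borel" "K \<in> sets borel"
    using T K by (auto intro: borel_compact)
  have S[measurable]: "?S \<in> sets (lborel \<Otimes>\<^sub>M lborel)" using borel_prisms[OF K] .
  have [measurable]: "?A \<in> sets borel" by measurable
  have "(\<integral>\<^sup>+t. ennreal (section_vol K u t) * indicator T t \<partial>lborel)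
      = (\<integral>\<^sup>+t. \<integral>\<^sup>+y. indicator ?S (t, y) * indicator T t \<partial>lborel \<partial>lborel)"
  proof (rule nn_integral_cong)
    fix t :: real
    have b: "?P t \<in> sets lborel"
      using sets_Pair1[OF S, of t] by (simp add: vimage_def)
    have "(\<integral>\<^sup>+y. indicator ?S (t, y) * indicator T t \<partial>lborel)
        = (\<integral>\<^sup>+y. indicator (?P t) y * indicator T t \<partial>lborel)"
      by (intro nn_integral_cong) (auto simp: indicator_def)
    also have "\<dots> = emeasure lborel (?P t) * indicator T t"
      using b by (simp add: nn_integral_multc)
    finally show "ennreal (section_vol K u t) * indicator T t
        = (\<integral>\<^sup>+y. indicator ?S (t, y) * indicator T t \<partial>lborel)"
      by (simp add: emeasure_prism[OF u K])
  qed
  also have "\<dots> = (\<integral>\<^sup>+y. \<integral>\<^sup>+t. indicator ?S (t, y) * indicator T t \<partial>lborel \<partial>lborel)"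
    by (rule lborel_pair.Fubini'[symmetric]) measurable
  also have "\<dots> = (\<integral>\<^sup>+y. \<integral>\<^sup>+h. indicator {0..1::real} h * indicator ?A (y - h *\<^sub>R u) \<partial>lborel \<partial>lborel)"
  proof (rule nn_integral_cong)
    fix y :: 'a
    have m: "(\<lambda>t. indicator ?S (t, y) * indicator T t :: ennreal) \<in> borel_measurable borel"
    proof -
      have "(\<lambda>t. indicator ?S (t, y) * indicator T t :: ennreal) \<in> borel_measurable lborel" by measurable
      then show ?thesis by simp
    qed
    \<comment> \<open>The substitution \<open>t = y \<bullet> u - h\<close>, whose slope
      \<open>-1\<close> contributes the factor 1.\<close>
    have "(\<integral>\<^sup>+t. indicator ?S (t, y) * indicator T t \<partial>lborel)
      = ennreal \<bar>-1\<bar> * (\<integral>\<^sup>+h. indicator ?S (y \<bullet> u + (-1) * h, y) * indicator T (y \<bullet> u + (-1) * h) \<partial>lborel)"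
      by (rule nn_integral_real_affine[OF m]) simp
    also have "\<dots> = (\<integral>\<^sup>+h. indicator {0..1::real} h * indicator ?A (y - h *\<^sub>R u) \<partial>lborel)"
      by (auto intro!: nn_integral_cong simp: indicator_def inner_diff_left uu)
    finally show "(\<integral>\<^sup>+t. indicator ?S (t, y) * indicator T t \<partial>lborel)
      = (\<integral>\<^sup>+h. indicator {0..1::real} h * indicator ?A (y - h *\<^sub>R u) \<partial>lborel)" .
  qed
  also have "\<dots> = (\<integral>\<^sup>+h. \<integral>\<^sup>+y. indicator {0..1::real} h * indicator ?A (y - h *\<^sub>R u) \<partial>lborel \<partial>lborel)"
    by (rule lborel_pair.Fubini'[symmetric]) measurable
  \<comment> \<open>For fixed \<open>h\<close> the inner integral is the measure of a translate of
    \<open>?A\<close>, hence independent of \<open>h\<close>; the heights fill an interval of length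
    1, so no further factor remains.\<close>
  also have "\<dots> = (\<integral>\<^sup>+h. indicator {0..1::real} h * emeasure lborel ?A \<partial>lborel)"
  proof (rule nn_integral_cong)
    fix h :: real
    have "(\<integral>\<^sup>+y. indicator {0..1::real} h * indicator ?A (y - h *\<^sub>R u) \<partial>lborel)
      = indicator {0..1::real} h * (\<integral>\<^sup>+y. indicator ?A (- (h *\<^sub>R u) + y) \<partial>lborel)"
      by (simp add: nn_integral_cmult)
    also have "(\<integral>\<^sup>+y. indicator ?A (- (h *\<^sub>R u) + y) \<partial>lborel)
      = (\<integral>\<^sup>+y. indicator ?A y \<partial>distr lborel borel ((+) (- (h *\<^sub>R u))))"
      by (rule nn_integral_distr[symmetric]) measurable
    also have "\<dots> = emeasure lborel ?A"
      by (simp add: lborel_distr_plus del: Int_iff)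
    finally show "(\<integral>\<^sup>+y. indicator {0..1::real} h * indicator ?A (y - h *\<^sub>R u) \<partial>lborel)
      = indicator {0..1::real} h * emeasure lborel ?A" .
  qed
  also have "\<dots> = emeasure lborel ?A"
    by (simp add: nn_integral_multc)
  finally show ?thesis .
qed

text \<open>A prism of height 1 over a section stays within distance 1 of \<open>K\<close>, so one
  ball contains the prisms for all \<open>t\<close>.\<close>

lemma section_vol_bounded:
  fixes K :: "'a::euclidean_space set"
  assumes "norm u = 1" "compact K"
  obtains M where "\<And>t. section_vol K u t \<le> M"
proof -
  obtain R where R: "\<And>x. x \<in> K \<Longrightarrow> norm x \<le> R"
    using compact_imp_bounded[OF assms(2)] by (auto simp: bounded_iff)
  show ?thesis
  proof
    fix t
    let ?P = "(\<lambda>(x, h). x + h *\<^sub>R u) ` ((K \<inter> {x. x \<bullet> u = t}) \<times> {0..1::real})"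
    have "?P \<subseteq> cball 0 (R + 1)"
      using R assms(1) by (auto simp: intro!: norm_triangle_mono)
    then show "section_vol K u t \<le> measure lebesgue (cball (0::'a) (R + 1))"
      unfolding section_vol_def
      by (intro measure_mono_fmeasurable)
        (auto intro: fmeasurableD lmeasurable_compact compact_prism[OF assms(2)])
  qed
qed

lemma section_vol_support:
  assumes "section_vol K u t > 0"
  obtains x where "x \<in> K" "x \<bullet> u = t"
proof -
  have "K \<inter> {x. x \<bullet> u = t} \<noteq> {}"
    using assms unfolding section_vol_def by (metis Sigma_empty1 image_empty measure_empty less_irrefl)
  then show ?thesis using that by auto
qed

text \<open>Fubini in gauge-integral form. With \<open>T\<close> a half-line or \<open>UNIV\<close>
  it identifies volumes of parts of \<open>K\<close> with values of the distribution function of the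
  sections.\<close>

lemma has_integral_section_vol:
  fixes K :: "'a::euclidean_space set"
  assumes "norm u = 1" "compact K" "T \<in> sets borel"
  shows "(section_vol K u has_integral measure lebesgue (K \<inter> {x. x \<bullet> u \<in> T})) T"
proof -
  let ?A = "K \<inter> {x. x \<bullet> u \<in> T}" and ?f = "\<lambda>t. section_vol K u t * indicator T t"
  have [measurable]: "section_vol K u \<in> borel_measurable borel" "T \<in> sets borel" "K \<in> sets borel"
    using section_vol_measurable[OF assms(1,2)] assms(3) borel_compact[OF assms(2)] by auto
  have A: "?A \<in> sets borel" by measurable
  have "emeasure lborel ?A \<le> emeasure lborel K" by (intro emeasure_mono) auto
  then have "emeasure lborel ?A < \<infinity>"
    using emeasure_compact_finite[OF assms(2)] by (rule order_le_less_trans)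
  then have fin: "emeasure lborel ?A = ennreal (measure lebesgue ?A)"
    using A by (simp add: emeasure_eq_ennreal_measure less_top)
  have "(?f has_integral measure lebesgue ?A) UNIV"
  proof (rule nn_integral_has_integral)
    show "?f \<in> borel_measurable borel" by measurable
    show "0 \<le> ?f t" for t by (simp add: section_vol_def)
    have "(\<integral>\<^sup>+t. ennreal (?f t) \<partial>lborel) = (\<integral>\<^sup>+t. ennreal (section_vol K u t) * indicator T t \<partial>lborel)"
      by (intro nn_integral_cong) (simp add: indicator_def)
    then show "(\<integral>\<^sup>+t. ennreal (?f t) \<partial>lborel) = ennreal (measure lebesgue ?A)"
      by (simp only: nn_integral_section_vol[OF assms] fin)
  qed simp
  moreover have "?f = (\<lambda>t. if t \<in> T then section_vol K u t else 0)" by auto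
  ultimately show ?thesis by (simp only: has_integral_restrict_UNIV)
qed

section \<open>Densities with a concave power\<close>

text \<open>On the middle third of the interval the continuous function \<open>g\<close> attains a
  positive minimum, which bounds the integral from below; the values at \<open>a\<close> and
  \<open>b\<close> do not affect the integral.\<close>

lemma integral_pos_of_interior_pos:
  fixes g :: "real \<Rightarrow> real"
  assumes "a < b" "g integrable_on {a..b}" "continuous_on {a<..<b} g"
    and pos: "\<And>x. x \<in> {a<..<b} \<Longrightarrow> 0 < g x"
  shows "0 < integral {a..b} g"
proof -
  define c d where "c = (2 * a + b) / 3" and "d = (a + 2 * b) / 3"
  have cd: "a < c" "c < d" "d < b"
    using assms(1) by (auto simp: c_def d_def)
  have sub: "{c..d} \<subseteq> {a<..<b}" using cd by auto
  then have cont: "continuous_on {c..d} g"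
    using assms(3) continuous_on_subset by blast
  obtain z where z: "z \<in> {c..d}" "\<And>y. y \<in> {c..d} \<Longrightarrow> g z \<le> g y"
    using continuous_attains_inf[OF compact_Icc _ cont] cd by auto
  have "0 < (d - c) * g z" using pos z(1) sub cd by auto
  also have "\<dots> = integral {c..d} (\<lambda>x. g z)" using cd by simp
  also have "\<dots> \<le> integral {c..d} g"
    by (rule integral_le) (use z cont in \<open>auto intro: integrable_continuous_real\<close>)
  also have "\<dots> \<le> integral {a<..<b} g"
    using integrable_continuous_real[OF cont] assms(2) less_imp_le[OF pos]
    by (intro integral_subset_le sub) (auto simp only: integrable_on_Icc_iff_Ioo)
  finally show ?thesis by (simp add: integral_open_interval_real)
qed

text \<open>Chebyshev's argument: replacing the increasing weight \<open>\<tau>\<close> by its value at the sign change of the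
  increasing function \<open>D\<close> can only decrease the integrand.\<close>
lemma chebyshev_integral_nonneg:
  fixes D \<rho> \<tau> \<psi> :: "real \<Rightarrow> real"
  assumes w: "(\<lambda>x. D x * (\<rho> x * \<tau> x)) integrable_on {a..b}"
    and psi: "(\<psi> has_integral 0) {a..b}"
    and le: "\<And>x. x \<in> {a<..<b} \<Longrightarrow> \<psi> x \<le> D x * \<rho> x"
    and rho: "\<And>x. x \<in> {a<..<b} \<Longrightarrow> 0 \<le> \<rho> x"
    and tau: "\<And>x. x \<in> {a<..<b} \<Longrightarrow> 0 \<le> \<tau> x"
    and tau_mono: "mono_on {a<..<b} \<tau>"
    and D_mono: "mono_on {a<..<b} D"
    and z: "z \<in> {a<..<b}" "D z = 0"
  shows "0 \<le> integral {a..b} (\<lambda>x. D x * (\<rho> x * \<tau> x))"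
proof -
  have "((\<lambda>x. \<tau> z * \<psi> x) has_integral 0) {a..b}"
    using has_integral_mult_right[OF psi, of "\<tau> z"] by simp
  then have 1: "((\<lambda>x. \<tau> z * \<psi> x) has_integral 0) {a<..<b}"
    by (simp add: has_integral_Icc_iff_Ioo)
  have 2: "((\<lambda>x. D x * (\<rho> x * \<tau> x)) has_integral integral {a..b} (\<lambda>x. D x * (\<rho> x * \<tau> x))) {a<..<b}"
    using integrable_integral[OF w] by (simp add: has_integral_Icc_iff_Ioo)
  show ?thesis
  proof (rule has_integral_le[OF 1 2])
    fix x assume x: "x \<in> {a<..<b}"
    have "0 \<le> D x * (\<tau> x - \<tau> z)"
    proof (cases "x \<le> z")
      case True
      then have "D x \<le> 0" "\<tau> x \<le> \<tau> z"
        using mono_onD[OF D_mono x z(1)] mono_onD[OF tau_mono x z(1)] z(2) by auto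
      then show ?thesis by (simp add: mult_nonpos_nonpos)
    next
      case False
      then have "0 \<le> D x" "\<tau> z \<le> \<tau> x"
        using mono_onD[OF D_mono z(1) x] mono_onD[OF tau_mono z(1) x] z(2) by auto
      then show ?thesis by simp
    qed
    then have "0 \<le> \<rho> x * (D x * (\<tau> x - \<tau> z))" using rho[OF x] by simp
    \<comment> \<open>A minorant \<open>\<psi>\<close> of \<open>D * \<rho>\<close> is enough here,
      because it is multiplied by the nonnegative constant \<open>\<tau> z\<close>.\<close>
    moreover have "\<tau> z * \<psi> x \<le> \<tau> z * (D x * \<rho> x)"
      using le[OF x] tau[OF z(1)] by (rule mult_left_mono)
    ultimately show "\<tau> z * \<psi> x \<le> D x * (\<rho> x * \<tau> x)"
      by (simp add: algebra_simps)
  qed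
qed

lemma concave_on_ge_chord:
  fixes h :: "real \<Rightarrow> real"
  assumes "concave_on S h" "s \<in> S" "t \<in> S" "s < t" "x \<in> {s..t}"
  shows "h s + (h t - h s) / (t - s) * (x - s) \<le> h x"
proof -
  define k where "k = (x - s) / (t - s)"
  have k: "0 \<le> k" "k \<le> 1" "k * (t - s) = x - s"
    using assms by (auto simp: k_def)
  then have "(1 - k) *\<^sub>R s + k *\<^sub>R t = x" by (simp add: algebra_simps)
  then have "(1 - k) * h s + k * h t \<le> h x"
    using concave_onD[OF assms(1) k(1,2) assms(2,3)] by simp
  moreover have "(h t - h s) / (t - s) * (x - s) = k * (h t - h s)" by (simp add: k_def)
  ultimately show ?thesis by (simp add: algebra_simps)
qed

text \<open>This is the chord bound on \<open>{x..t}\<close> at the intermediate point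
  \<open>s\<close>, solved for \<open>h x\<close>.\<close>

lemma concave_on_le_extrapolation:
  fixes h :: "real \<Rightarrow> real"
  assumes "concave_on S h" "x \<in> S" "t \<in> S" "x \<le> s" "s < t"
  shows "h x \<le> h s + (h t - h s) / (t - s) * (x - s)"
proof -
  have "h x + (h t - h x) / (t - x) * (s - x) \<le> h s"
    using assms by (intro concave_on_ge_chord[of S]) auto
  then have "(h t - h x) * (s - x) / (t - x) \<le> h s - h x" by simp
  then have "(h t - h x) * (s - x) \<le> (h s - h x) * (t - x)"
    using assms by (simp add: pos_divide_le_eq)
  then have "h x * (t - s) \<le> h s * (t - s) + (h t - h s) * (x - s)"
    by (simp add: algebra_simps)
  then have "(h x - h s) * (t - s) \<le> (h t - h s) * (x - s)"
    by (simp add: algebra_simps)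
  then have "h x - h s \<le> (h t - h s) * (x - s) / (t - s)"
    using assms by (simp add: pos_le_divide_eq)
  then show ?thesis by simp
qed

text \<open>The affine base may vanish at the left end, where the derivative rule for
  \<open>powr\<close> does not apply; so derivatives are taken in the interior only.\<close>

lemma has_integral_powr_linear:
  fixes m c s q :: real
  assumes "x \<le> y" "0 < m" "0 < q" and nonneg: "0 \<le> c + m * (x - s)"
  shows "((\<lambda>x. (c + m * (x - s)) powr q) has_integral
    (c + m * (y - s)) powr (q + 1) / (m * (q + 1)) - (c + m * (x - s)) powr (q + 1) / (m * (q + 1))) {x..y}"
proof (rule fundamental_theorem_of_calculus_interior[OF assms(1)])
  have pos: "0 \<le> c + m * (z - s)" if "z \<in> {x..y}" for z
  proof -
    have "m * x \<le> m * z" using that \<open>0 < m\<close> by simp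
    then show ?thesis using nonneg unfolding right_diff_distrib by linarith
  qed
  show "continuous_on {x..y} (\<lambda>z. (c + m * (z - s)) powr (q + 1) / (m * (q + 1)))"
    using assms pos by (intro continuous_intros continuous_on_powr') auto
  fix z assume z: "z \<in> {x<..<y}"
  have "m * x < m * z" using z \<open>0 < m\<close> by simp
  then have "0 < c + m * (z - s)" using nonneg unfolding right_diff_distrib by linarith
  moreover have "((\<lambda>z. c + m * (z - s)) has_real_derivative m) (at z)"
    by (auto intro!: derivative_eq_intros)
  ultimately have "((\<lambda>z. (c + m * (z - s)) powr (q + 1) / (m * (q + 1))) has_real_derivative
      (c + m * (z - s)) powr q) (at z)"
    using assms DERIV_cdivide[OF DERIV_fun_powr, of "\<lambda>z. c + m * (z - s)" m z "q + 1" "m * (q + 1)"]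
    by simp
  then show "((\<lambda>z. (c + m * (z - s)) powr (q + 1) / (m * (q + 1))) has_vector_derivative
      (c + m * (z - s)) powr q) (at z)"
    by (simp add: has_real_derivative_iff_has_vector_derivative)
qed

text \<open>The one-dimensional situation left after slicing. Concavity and positivity are required
  on the open interval only, since \<open>f\<close> may jump at the ends of its support; the bound
  \<open>M\<close> provides integrability of its powers.\<close>

locale concave_power_profile =
  fixes f :: "real \<Rightarrow> real" and a b p M :: real
  assumes ab: "a < b" and p: "0 < p"
    and f_meas: "f \<in> borel_measurable borel"
    and f_nonneg: "\<And>x. 0 \<le> f x"
    and f_le: "\<And>x. f x \<le> M"
    and f_pos: "\<And>x. x \<in> {a<..<b} \<Longrightarrow> 0 < f x"
    and conc: "concave_on {a<..<b} (\<lambda>x. f x powr p)"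
begin

section \<open>Continuity and integrability of the profile\<close>

lemma f_root: "x \<in> {a<..<b} \<Longrightarrow> f x = (f x powr p) powr (1 / p)"
  using f_pos[of x] p by (simp add: powr_powr)

lemma continuous_f: "continuous_on {a<..<b} f"
proof -
  have "continuous_on {a<..<b} (\<lambda>x. - (f x powr p))"
    using conc by (intro convex_on_continuous) (auto simp: concave_on_def)
  then have "continuous_on {a<..<b} (\<lambda>x. f x powr p)"
    using continuous_on_minus by fastforce
  then have "continuous_on {a<..<b} (\<lambda>x. (f x powr p) powr (1 / p))"
    by (rule continuous_on_powr[OF _ continuous_on_const]) (use f_pos in force)
  then show ?thesis by (rule continuous_on_eq) (simp add: f_root[symmetric])
qed

lemma bounded_continuous_mult_powr:
  assumes "continuous_on {c..d} g" "0 \<le> r"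
  obtains B where "\<And>x. x \<in> {c..d} \<Longrightarrow> \<bar>g x * f x powr r\<bar> \<le> B"
proof -
  obtain B where "\<forall>y\<in>g ` {c..d}. norm y \<le> B"
    using compact_imp_bounded[OF compact_continuous_image[OF assms(1) compact_Icc]]
    unfolding bounded_iff by blast
  then have B: "\<bar>g x\<bar> \<le> B" if "x \<in> {c..d}" for x using that by simp
  show ?thesis
  proof
    show "\<bar>g x * f x powr r\<bar> \<le> B * M powr r" if "x \<in> {c..d}" for x
      using mult_mono[OF B[OF that] powr_mono2[OF assms(2) f_nonneg f_le]] B[OF that]
      by (simp add: abs_mult)
  qed
qed

lemma integrable_continuous_mult_powr:
  assumes "continuous_on {c..d} g" "0 \<le> r"
  shows "(\<lambda>x. g x * f x powr r) integrable_on {c..d}"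
proof -
  obtain B where B: "\<And>x. x \<in> {c..d} \<Longrightarrow> \<bar>g x * f x powr r\<bar> \<le> B"
    using bounded_continuous_mult_powr[OF assms] by blast
  show ?thesis
  proof (rule measurable_bounded_by_integrable_imp_integrable)
    have "(\<lambda>x. f x powr r) \<in> borel_measurable borel" using f_meas by measurable
    then have "(\<lambda>x. f x powr r) \<in> borel_measurable (lebesgue_on {c..d})"
      by (simp add: measurable_restrict_space1 measurable_completion)
    moreover have "g \<in> borel_measurable (lebesgue_on {c..d})"
      using assms(1) by (rule continuous_imp_measurable_on_sets_lebesgue) simp
    ultimately show "(\<lambda>x. g x * f x powr r) \<in> borel_measurable (lebesgue_on {c..d})"
      by (rule borel_measurable_times[rotated])
    show "norm (g x * f x powr r) \<le> B" if "x \<in> {c..d}" for x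
      using B[OF that] by simp
  qed auto
qed

text \<open>Bridge from the Lebesgue integrals in \<open>powered_centroid\<close> to gauge
  integrals.\<close>

lemma set_lebesgue_integral_mult_powr:
  assumes "continuous_on UNIV g" "0 \<le> r"
  shows "(LINT t:{c..d}|lborel. g t * f t powr r) = integral {c..d} (\<lambda>t. g t * f t powr r)"
proof (rule set_borel_integral_eq_integral)
  have g: "continuous_on {c..d} g" using assms(1) continuous_on_subset by blast
  obtain B where B: "\<And>x. x \<in> {c..d} \<Longrightarrow> \<bar>g x * f x powr r\<bar> \<le> B"
    using bounded_continuous_mult_powr[OF g assms(2)] by blast
  have [measurable]: "g \<in> borel_measurable borel" "f \<in> borel_measurable borel"
    using borel_measurable_continuous_onI[OF assms(1)] f_meas by auto
  show "set_integrable lborel {c..d} (\<lambda>t. g t * f t powr r)"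
    unfolding set_integrable_def
  proof (rule integrableI_bounded_set_indicator)
    show "AE x in lborel. x \<in> {c..d} \<longrightarrow> norm (g x * f x powr r) \<le> B"
      using B by simp
    show "emeasure lborel {c..d} < \<infinity>"
      by (rule emeasure_compact_finite) simp
  qed measurable
qed

lemma integrable_f: "f integrable_on {c..d}"
  using integrable_continuous_mult_powr[of c d "\<lambda>_. 1" 1] f_nonneg by simp

section \<open>The distribution function of the profile\<close>

definition F :: "real \<Rightarrow> real" where "F x = integral {a..x} f"

definition V :: real where "V = F b"

lemma F_a [simp]: "F a = 0"
  by (simp add: F_def)

lemma F_diff: "a \<le> x \<Longrightarrow> x \<le> y \<Longrightarrow> F y - F x = integral {x..y} f"
  using Henstock_Kurzweil_Integration.integral_combine[OF _ _ integrable_f, of a x y] by (simp add: F_def)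

lemma integral_f_pos:
  assumes "a \<le> x" "x < y" "y \<le> b"
  shows "0 < integral {x..y} f"
  using assms by (intro integral_pos_of_interior_pos integrable_f continuous_on_subset[OF continuous_f] f_pos) auto

lemma F_less: "a \<le> x \<Longrightarrow> x < y \<Longrightarrow> y \<le> b \<Longrightarrow> F x < F y"
  using F_diff[of x y] integral_f_pos[of x y] by simp

lemma F_pos: "a < x \<Longrightarrow> x \<le> b \<Longrightarrow> 0 < F x"
  using F_less[of a x] by simp

lemma F_less_V: "a \<le> x \<Longrightarrow> x < b \<Longrightarrow> F x < V"
  using F_less[of x b] by (simp add: V_def)

lemma V_pos: "0 < V"
  using F_pos[of b] ab by (simp add: V_def)

lemma F_bounds: "x \<in> {a..b} \<Longrightarrow> 0 \<le> F x \<and> F x \<le> V"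
  using F_pos[of x] F_less_V[of x] F_a ab by (cases "x = a"; cases "x = b") (auto simp: V_def less_imp_le)

lemma continuous_F: "continuous_on {a..b} F"
  using indefinite_integral_continuous_1[OF integrable_f] by (simp add: F_def[abs_def])

lemma F_derivative:
  assumes "x \<in> {a<..<b}"
  shows "(F has_real_derivative f x) (at x)"
proof -
  have "continuous (at x) f"
    using continuous_f assms by (simp add: continuous_on_eq_continuous_at)
  then have "((\<lambda>u. integral {a..u} f) has_vector_derivative f x) (at x within ({a..b} - {}))"
    using assms by (intro integral_has_vector_derivative_continuous_at integrable_f)
      (auto intro: continuous_at_imp_continuous_at_within)
  moreover have "at x within {a..b} = at x" using assms by (intro at_within_interior) simp
  ultimately show ?thesis
    by (simp add: F_def[abs_def] has_real_derivative_iff_has_vector_derivative)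
qed

section \<open>Monotonicity of \<open>f powr (p + 1)\<close> relative to \<open>F\<close> and to
  \<open>V - F\<close>\<close>

text \<open>Compare \<open>f powr p\<close> with its chord through \<open>s\<close> and \<open>t\<close>, extended to the left down to its zero:
  it lies below the line before \<open>s\<close> and above it between \<open>s\<close> and \<open>t\<close>. For a line both
  \<open>F\<close> and \<open>f powr (p + 1)\<close> are multiples of the same power.\<close>
lemma F_ratio:
  assumes "a < s" "s \<le> t" "t < b"
  shows "f t powr (p + 1) * F s \<le> f s powr (p + 1) * F t"
proof (cases "f t \<le> f s")
  \<comment> \<open>If \<open>f\<close> does not grow from \<open>s\<close> to \<open>t\<close>,
    both factors compare in the required direction. Otherwise the chord of \<open>f powr p\<close>
    has positive slope.\<close>
  case True
  have "F s \<le> F t" using F_less[of s t] assms by (cases "s = t") auto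
  moreover have "f t powr (p + 1) \<le> f s powr (p + 1)"
    using True p f_nonneg by (intro powr_mono2) auto
  ultimately show ?thesis using F_pos[of s] assms by (intro mult_mono) auto
next
  case False
  then have st: "s < t" using assms by (cases "s = t") auto
  define h where "h = (\<lambda>x. f x powr p)"
  define m where "m = (h t - h s) / (t - s)"
  define q where "q = 1 / p"
  define l where "l = (\<lambda>x. h s + m * (x - s))"
  have q: "0 < q" using p by (simp add: q_def)
  have fh: "f x = h x powr q" if "x \<in> {a<..<b}" for x
    using f_root[OF that] by (simp add: h_def q_def)
  have hpos: "0 < h x" if "x \<in> {a<..<b}" for x
    using f_pos[OF that] by (simp add: h_def)
  have "h s < h t" using False f_nonneg p unfolding h_def by (intro powr_less_mono2) auto
  then have m: "0 < m" using st by (simp add: m_def)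
  have below: "h x \<le> l x" if "x \<in> {a<..s}" for x
    using concave_on_le_extrapolation[OF conc, of x t s] that assms st
    by (simp add: h_def l_def m_def)
  have above: "l x \<le> h x" if "x \<in> {s..t}" for x
    using concave_on_ge_chord[OF conc, of s t x] that assms st by (simp add: h_def l_def m_def)
  have l_pos: "0 < l x" if "x \<in> {a<..s}" for x
    using below[OF that] hpos[of x] that assms by auto
  have l_a: "0 \<le> l a"
  proof (rule ccontr)
    assume n: "\<not> 0 \<le> l a"
    \<comment> \<open>A line negative at \<open>a\<close> would have its zero at
      \<open>a - l a / m\<close>, to the right of \<open>a\<close>. Cutting this off at
      \<open>s\<close> gives a point of \<open>{a<..s}\<close> where \<open>l\<close> is at most 0,
      against \<open>l_pos\<close>.\<close>
    define x where "x = min s (a - l a / m)"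
    have "x \<in> {a<..s}" using n m assms by (auto simp: x_def field_simps)
    moreover have "l x \<le> l a + m * (x - a)" by (simp add: l_def algebra_simps)
    moreover have "m * (x - a) \<le> - l a" using m by (simp add: x_def field_simps min_def)
    ultimately show False using l_pos[of x] by linarith
  qed
  define C where "C = 1 / (m * (q + 1))"
  have C: "0 < C" using m q by (simp add: C_def)
  have pw: "f x powr (p + 1) = h x powr (q + 1)" if "x \<in> {a<..<b}" for x
  proof -
    have "p * (q + 1) = p + 1" using p by (simp add: q_def distrib_left)
    then show ?thesis by (simp add: h_def powr_powr)
  qed
  have ls: "l s = h s" "l t = h t" using st by (auto simp: l_def m_def)
  have int_left: "((\<lambda>x. l x powr q) has_integral C * h s powr (q + 1) - C * l a powr (q + 1)) {a..s}"
    using has_integral_powr_linear[of a s m q "h s" s] assms m q l_a ls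
    by (simp add: l_def C_def)
  have int_right: "((\<lambda>x. l x powr q) has_integral C * h t powr (q + 1) - C * h s powr (q + 1)) {s..t}"
    using has_integral_powr_linear[of s t m q "h s" s] assms m q hpos[of s] ls
    by (simp add: l_def C_def)
  \<comment> \<open>Left of \<open>s\<close> the line dominates; the contribution of the
    antiderivative at \<open>a\<close> is nonnegative and is then dropped.\<close>
  have "F s \<le> C * h s powr (q + 1) - C * l a powr (q + 1)"
  proof (rule has_integral_le)
    show "(f has_integral F s) {a<..<s}"
      using integrable_integral[OF integrable_f, of a s] by (simp add: F_def has_integral_Icc_iff_Ioo)
    show "((\<lambda>x. l x powr q) has_integral C * h s powr (q + 1) - C * l a powr (q + 1)) {a<..<s}"
      using int_left by (simp add: has_integral_Icc_iff_Ioo)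
    show "f x \<le> l x powr q" if "x \<in> {a<..<s}" for x
      using below[of x] hpos[of x] that assms q by (auto simp: fh intro!: powr_mono2)
  qed
  also have "\<dots> \<le> C * h s powr (q + 1)" using C by simp
  finally have 1: "F s \<le> C * h s powr (q + 1)" .
  have "C * h t powr (q + 1) - C * h s powr (q + 1) \<le> integral {s..t} f"
  proof (rule has_integral_le[OF int_right integrable_integral[OF integrable_f]])
    show "l x powr q \<le> f x" if "x \<in> {s..t}" for x
    proof -
      have "0 \<le> l x" using hpos[of s] m that assms by (simp add: l_def)
      then show ?thesis using above[OF that] that assms q by (auto simp: fh intro!: powr_mono2)
    qed
  qed
  then have 2: "C * (h t powr (q + 1) - h s powr (q + 1)) \<le> F t - F s"
    using F_diff[of s t] assms by (simp add: algebra_simps)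
  define X Y where "X = h s powr (q + 1)" and "Y = h t powr (q + 1)"
  have "X \<le> Y" using \<open>h s < h t\<close> hpos[of s] assms q unfolding X_def Y_def by (intro powr_mono2) auto
  \<comment> \<open>The bounds \<open>F s \<le> C * X\<close> and
    \<open>C * (Y - X) \<le> F t - F s\<close> are joined through \<open>C * X * (Y - X)\<close>;
    the terms \<open>X * F s\<close> then cancel.\<close>
  then have "F s * (Y - X) \<le> C * X * (Y - X)"
    using 1 by (intro mult_right_mono) (auto simp: X_def)
  moreover have "X * (C * (Y - X)) \<le> X * (F t - F s)"
    using 2 by (intro mult_left_mono) (auto simp: X_def Y_def)
  ultimately have "Y * F s \<le> X * F t" by (simp add: algebra_simps)
  then show ?thesis using assms by (simp add: pw X_def Y_def)
qed

text \<open>Reflection exchanges \<open>F\<close> with \<open>V - F\<close>, so that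
  \<open>F_ratio\<close> also yields \<open>complement_ratio\<close>.\<close>

lemma reflected: "concave_power_profile (\<lambda>x. f (- x)) (- b) (- a) p M"
proof
  show "concave_on {- b<..<- a} (\<lambda>x. f (- x) powr p)"
    unfolding concave_on_iff
  proof (intro conjI ballI allI impI)
    fix x y u v :: real
    assume "x \<in> {- b<..<- a}" "y \<in> {- b<..<- a}" "0 \<le> u" "0 \<le> v" "u + v = 1"
    moreover have "- (u *\<^sub>R x + v *\<^sub>R y) = u *\<^sub>R (- x) + v *\<^sub>R (- y)" by simp
    ultimately show "u * f (- x) powr p + v * f (- y) powr p \<le> f (- (u *\<^sub>R x + v *\<^sub>R y)) powr p"
      using conc unfolding concave_on_iff by (simp only:) (simp del: scaleR_minus_right real_scaleR_def)
  qed simp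
qed (use ab p f_meas f_nonneg f_le f_pos in auto)

lemma complement_ratio:
  assumes "a < s" "s \<le> t" "t < b"
  shows "f s powr (p + 1) * (V - F t) \<le> f t powr (p + 1) * (V - F s)"
proof -
  interpret r: concave_power_profile "\<lambda>x. f (- x)" "- b" "- a" p M by (rule reflected)
  have "r.F (- x) = V - F x" if "a \<le> x" "x \<le> b" for x
    using F_diff[of x b] that by (simp add: r.F_def V_def)
  then show ?thesis using r.F_ratio[of "- t" "- s"] assms by simp
qed

section \<open>Concavity of \<open>F powr \<theta>\<close> and Jensen's inequality\<close>

text \<open>If \<open>f powr p\<close> is a line vanishing at \<open>a\<close>, then
  \<open>F\<close> is a multiple of that line to the power \<open>(p + 1) / p\<close>; this exponent
  makes \<open>F powr \<theta>\<close> affine.\<close>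

definition \<theta> :: real where "\<theta> = p / (p + 1)"

lemma \<theta>_pos: "0 < \<theta>"
  using p by (simp add: \<theta>_def)

lemma \<theta>_le_1: "\<theta> \<le> 1"
  using p by (simp add: \<theta>_def)

lemma \<theta>_mult: "(p + 1) * \<theta> = p"
  using p by (simp add: \<theta>_def)

lemma F_powr_derivative:
  assumes "x \<in> {a<..<b}"
  shows "((\<lambda>x. F x powr k) has_real_derivative k * F x powr (k - 1) * f x) (at x)"
  using DERIV_fun_powr[OF F_derivative[OF assms], of k] F_pos[of x] assms by simp

lemma complement_powr_derivative:
  assumes "x \<in> {a<..<b}"
  shows "((\<lambda>x. (V - F x) powr k) has_real_derivative - (k * (V - F x) powr (k - 1) * f x)) (at x)"
  using DERIV_fun_powr[OF DERIV_diff[OF DERIV_const F_derivative[OF assms]], of V k] F_less_V[of x] assms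
  by simp

text \<open>The derivative of \<open>F powr \<theta>\<close> is \<open>\<theta>\<close> times the
  \<open>(p + 1)\<close>-th root of \<open>f powr (p + 1) / F\<close>, which decreases by
  \<open>F_ratio\<close>; hence \<open>F powr \<theta>\<close> is concave.\<close>

lemma F_powr_le_tangent:
  assumes "x0 \<in> {a<..<b}" "x \<in> {a<..<b}"
  shows "F x powr \<theta> \<le> F x0 powr \<theta> + \<theta> * (f x0 * F x0 powr (- 1 / (p + 1))) * (x - x0)"
proof -
  have th: "\<theta> - 1 = - 1 / (p + 1)" using p by (simp add: \<theta>_def field_simps)
  define g where "g = (\<lambda>x. - (\<theta> * (f x * F x powr (- 1 / (p + 1)))))"
  have der: "((\<lambda>x. - (F x powr \<theta>)) has_real_derivative g x) (at x)" if "x \<in> {a<..<b}" for x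
    using DERIV_minus[OF F_powr_derivative[OF that, of \<theta>]] unfolding g_def th[symmetric]
    by (simp add: mult_ac)
  have eq: "f x * F x powr (- 1 / (p + 1)) = (f x powr (p + 1) / F x) powr (1 / (p + 1))"
    if "x \<in> {a<..<b}" for x
    using that F_pos[of x] f_pos[OF that] p by (simp add: powr_divide powr_powr powr_minus_divide)
  have mono: "g x \<le> g y" if "x \<in> {a<..<b}" "y \<in> {a<..<b}" "x \<le> y" for x y
  proof -
    have "f y powr (p + 1) / F y \<le> f x powr (p + 1) / F x"
      using F_ratio[of x y] that F_pos[of x] F_pos[of y] by (simp add: field_simps)
    then have "(f y powr (p + 1) / F y) powr (1 / (p + 1)) \<le> (f x powr (p + 1) / F x) powr (1 / (p + 1))"
      using p F_pos[of y] that by (intro powr_mono2) auto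
    then show ?thesis unfolding g_def eq[OF that(1)] eq[OF that(2)]
      using \<theta>_pos by (simp add: mult_left_mono)
  qed
  have "convex_on {a<..<b} (\<lambda>x. - (F x powr \<theta>))"
    by (rule convex_on_realI[OF _ der mono]) auto
  from convex_on_imp_above_tangent[OF this _ _ _ has_field_derivative_at_within[OF der], of x0 x]
  show ?thesis using assms by (simp add: g_def algebra_simps)
qed

text \<open>The tangent bound at \<open>0\<close> is integrated against \<open>f powr r\<close>; the
  linear term disappears by \<open>mean\<close>.\<close>

lemma F_powr_mean_le:
  assumes r: "0 \<le> r" and mean: "integral {a..b} (\<lambda>t. t * f t powr r) = 0" and "0 \<in> {a<..<b}"
  shows "integral {a..b} (\<lambda>t. F t powr \<theta> * f t powr r) \<le> F 0 powr \<theta> * integral {a..b} (\<lambda>t. f t powr r)"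
proof -
  define \<kappa> where "\<kappa> = \<theta> * (f 0 * F 0 powr (- 1 / (p + 1)))"
  have i1: "(\<lambda>t. F t powr \<theta> * f t powr r) integrable_on {a..b}"
    using \<theta>_pos F_bounds by (intro integrable_continuous_mult_powr continuous_on_powr' continuous_F continuous_on_const r) auto
  have i2: "(\<lambda>t. t * f t powr r) integrable_on {a..b}"
    using r by (intro integrable_continuous_mult_powr continuous_intros)
  have i3: "(\<lambda>t. f t powr r) integrable_on {a..b}"
    using integrable_continuous_mult_powr[of a b "\<lambda>_. 1" r] r by simp
  have "((\<lambda>t. F 0 powr \<theta> * f t powr r + \<kappa> * (t * f t powr r)) has_integral
     F 0 powr \<theta> * integral {a..b} (\<lambda>t. f t powr r) + \<kappa> * integral {a..b} (\<lambda>t. t * f t powr r)) {a..b}"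
    using i2 i3 by (intro has_integral_add has_integral_mult_right integrable_integral)
  then have upper: "((\<lambda>t. F 0 powr \<theta> * f t powr r + \<kappa> * (t * f t powr r)) has_integral
     F 0 powr \<theta> * integral {a..b} (\<lambda>t. f t powr r)) {a<..<b}"
    by (simp add: mean has_integral_Icc_iff_Ioo)
  have lower: "((\<lambda>t. F t powr \<theta> * f t powr r) has_integral
     integral {a..b} (\<lambda>t. F t powr \<theta> * f t powr r)) {a<..<b}"
    using integrable_integral[OF i1] by (simp add: has_integral_Icc_iff_Ioo)
  have "F t powr \<theta> * f t powr r \<le> F 0 powr \<theta> * f t powr r + \<kappa> * (t * f t powr r)"
    if "t \<in> {a<..<b}" for t
    using mult_right_mono[OF F_powr_le_tangent[OF assms(3) that], of "f t powr r"]
    by (simp add: \<kappa>_def algebra_simps)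
  then show ?thesis by (rule has_integral_le[OF lower upper])
qed

section \<open>Lower bounds for the weighted mean of \<open>F powr \<theta>\<close>\<close>

text \<open>The common part of both ranges of \<open>r\<close>: Chebyshev's argument with
  \<open>D = F powr \<theta> - c * V powr \<theta>\<close>. Each range supplies its factorization of
  \<open>f powr r\<close> and a minorant \<open>\<psi>\<close> with an explicit
  antiderivative.\<close>

lemma F_powr_deviation_nonneg:
  assumes r: "0 \<le> r" and c: "0 < c" "c < 1"
    and psi: "(\<psi> has_integral 0) {a..b}"
    and le: "\<And>x. x \<in> {a<..<b} \<Longrightarrow> \<psi> x \<le> (F x powr \<theta> - c * V powr \<theta>) * \<rho> x"
    and rho: "\<And>x. x \<in> {a<..<b} \<Longrightarrow> 0 \<le> \<rho> x"
    and tau: "\<And>x. x \<in> {a<..<b} \<Longrightarrow> 0 \<le> \<tau> x"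
    and tau_mono: "mono_on {a<..<b} \<tau>"
    and prod: "\<And>x. x \<in> {a<..<b} \<Longrightarrow> \<rho> x * \<tau> x = f x powr r"
  shows "c * V powr \<theta> * integral {a..b} (\<lambda>t. f t powr r) \<le> integral {a..b} (\<lambda>t. F t powr \<theta> * f t powr r)"
proof -
  note th = \<theta>_pos
  define D where "D = (\<lambda>x. F x powr \<theta> - c * V powr \<theta>)"
  have contD: "continuous_on {a..b} D"
    unfolding D_def using th F_bounds by (intro continuous_intros continuous_on_powr' continuous_F) auto
  \<comment> \<open>Because \<open>c\<close> lies strictly between 0 and 1, \<open>D\<close> changes
    sign inside the interval.\<close>
  have "D a < 0" using c V_pos by (simp add: D_def)
  moreover have "0 < D b" using c V_pos by (simp add: D_def V_def[symmetric])
  ultimately obtain z where z: "a \<le> z" "z \<le> b" "D z = 0"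
    using IVT'[of D a 0 b] contD ab by auto
  then have z': "z \<in> {a<..<b}"
    using \<open>D a < 0\<close> \<open>0 < D b\<close> by (cases "z = a"; cases "z = b") auto
  have Dmono: "mono_on {a<..<b} D"
  proof (rule mono_onI)
    fix x y assume "x \<in> {a<..<b}" "y \<in> {a<..<b}" "x \<le> y"
    then have "F x \<le> F y" using F_less[of x y] by (cases "x = y") auto
    then show "D x \<le> D y"
      using th F_bounds[of x] \<open>x \<in> _\<close> unfolding D_def by (intro diff_right_mono powr_mono2) auto
  qed
  have i: "(\<lambda>x. D x * f x powr r) integrable_on {a..b}"
    using contD r by (rule integrable_continuous_mult_powr)
  \<comment> \<open>The factorization of \<open>f powr r\<close> is known only in the open interval,
    so the two endpoints are removed as a null set.\<close>
  have sp: "integral {a..b} (\<lambda>x. D x * (\<rho> x * \<tau> x)) = integral {a..b} (\<lambda>x. D x * f x powr r)"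
    by (rule integral_spike[of "{a, b}"]) (auto simp: prod)
  have "0 \<le> integral {a..b} (\<lambda>x. D x * (\<rho> x * \<tau> x))"
  proof (rule chebyshev_integral_nonneg[OF _ psi _ rho tau tau_mono Dmono z' z(3)])
    show "(\<lambda>x. D x * (\<rho> x * \<tau> x)) integrable_on {a..b}"
      by (rule integrable_spike[OF i, of "{a, b}"]) (auto simp: prod)
  qed (use le in \<open>auto simp: D_def\<close>)
  also note sp
  also have "integral {a..b} (\<lambda>x. D x * f x powr r) =
      integral {a..b} (\<lambda>x. F x powr \<theta> * f x powr r) - integral {a..b} (\<lambda>x. c * V powr \<theta> * f x powr r)"
    unfolding D_def left_diff_distrib using r th F_bounds
    by (intro Henstock_Kurzweil_Integration.integral_diff integrable_continuous_mult_powr continuous_intros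
        continuous_on_powr' continuous_F) auto
  finally show ?thesis by simp
qed

text \<open>The constant is the mean of \<open>y powr \<theta>\<close> over \<open>[0, 1]\<close>
  for the weight \<open>y powr \<beta>\<close>, namely
  \<open>(\<beta> + 1) / (\<theta> + \<beta> + 1)\<close>. Here the minorant \<open>\<psi>\<close>
  is \<open>D * \<rho>\<close> itself.\<close>

lemma F_powr_mean_ge_small:
  assumes r: "0 \<le> r" "r \<le> 1"
  shows "(p + r) / (2 * p + r) * V powr \<theta> * integral {a..b} (\<lambda>t. f t powr r)
    \<le> integral {a..b} (\<lambda>t. F t powr \<theta> * f t powr r)"
proof -
  define \<beta> where "\<beta> = (r - 1) / (p + 1)"
  define c where "c = (p + r) / (2 * p + r)"
  have be: "\<beta> \<le> 0" using r p by (simp add: \<beta>_def divide_nonpos_pos)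
  have be1: "0 < \<beta> + 1" using r p by (simp add: \<beta>_def field_simps)
  note th = \<theta>_pos
  have beta_mult: "(p + 1) * \<beta> = r - 1" using p by (simp add: \<beta>_def)
  have ceq: "c = (\<beta> + 1) / (\<theta> + \<beta> + 1)"
  proof -
    have "(p + 1) * (\<beta> + 1) = p + r" "(p + 1) * (\<theta> + \<beta> + 1) = 2 * p + r"
      unfolding distrib_left[of "p + 1"] beta_mult \<theta>_mult by simp_all
    moreover have "(\<beta> + 1) / (\<theta> + \<beta> + 1) = ((p + 1) * (\<beta> + 1)) / ((p + 1) * (\<theta> + \<beta> + 1))"
      using p by (intro mult_divide_mult_cancel_left[symmetric]) simp
    ultimately show ?thesis unfolding c_def by simp
  qed
  define \<Phi> where "\<Phi> = (\<lambda>x. F x powr (\<theta> + \<beta> + 1) / (\<theta> + \<beta> + 1) - c * V powr \<theta> * F x powr (\<beta> + 1) / (\<beta> + 1))"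
  define \<rho> where "\<rho> = (\<lambda>x. f x * F x powr \<beta>)"
  define \<tau> where "\<tau> = (\<lambda>x. (f x powr (p + 1) / F x) powr \<beta>)"
  have "((\<lambda>x. (F x powr \<theta> - c * V powr \<theta>) * \<rho> x) has_integral \<Phi> b - \<Phi> a) {a..b}"
  \<comment> \<open>For negative \<open>\<beta>\<close> the factor \<open>F powr \<beta>\<close>
    blows up at \<open>a\<close>; but \<open>\<beta> + 1 > 0\<close> keeps \<open>\<Phi>\<close>
    continuous there.\<close>
  proof (rule fundamental_theorem_of_calculus_interior)
    have "continuous_on {a..b} (\<lambda>x. F x powr k)" if "0 < k" for k
      using that F_bounds by (intro continuous_on_powr' continuous_F continuous_on_const) auto
    moreover have "0 < \<theta> + \<beta> + 1" using be1 th by simp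
    ultimately show "continuous_on {a..b} \<Phi>"
      unfolding \<Phi>_def using be1
      by (intro continuous_on_diff continuous_on_divide continuous_on_mult continuous_on_const) auto
    fix x assume x: "x \<in> {a<..<b}"
    have "(\<Phi> has_real_derivative (F x powr \<theta> - c * V powr \<theta>) * \<rho> x) (at x)"
      unfolding \<Phi>_def
    proof (rule DERIV_cong[OF DERIV_diff[OF DERIV_cdivide[OF F_powr_derivative[OF x]]
            DERIV_cdivide[OF DERIV_cmult[OF F_powr_derivative[OF x]]]]])
      have "\<theta> + \<beta> + 1 \<noteq> 0" "\<beta> + 1 \<noteq> 0" using be1 th by auto
      then show "(\<theta> + \<beta> + 1) * F x powr (\<theta> + \<beta> + 1 - 1) * f x / (\<theta> + \<beta> + 1)
          - c * V powr \<theta> * ((\<beta> + 1) * F x powr (\<beta> + 1 - 1) * f x) / (\<beta> + 1)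
        = (F x powr \<theta> - c * V powr \<theta>) * \<rho> x"
        by (simp add: \<rho>_def powr_add left_diff_distrib)
    qed
    then show "(\<Phi> has_vector_derivative (F x powr \<theta> - c * V powr \<theta>) * \<rho> x) (at x)"
      by (simp add: has_real_derivative_iff_has_vector_derivative)
  qed (use ab in simp)
  \<comment> \<open>The value of \<open>c\<close> is the one that makes \<open>\<Phi>\<close> vanish
    at \<open>b\<close>.\<close>
  moreover have "\<Phi> b - \<Phi> a = 0"
    using be1 th V_pos by (simp add: \<Phi>_def V_def[symmetric] ceq powr_add)
  ultimately have psi: "((\<lambda>x. (F x powr \<theta> - c * V powr \<theta>) * \<rho> x) has_integral 0) {a..b}" by simp
  show ?thesis unfolding c_def[symmetric]
  proof (rule F_powr_deviation_nonneg[OF r(1) _ _ psi order_refl])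
    show "0 < c" "c < 1" using be1 th by (simp_all add: ceq)
    show "mono_on {a<..<b} \<tau>"
    proof (rule mono_onI)
      fix x y assume xy: "x \<in> {a<..<b}" "y \<in> {a<..<b}" "x \<le> y"
      then have "f y powr (p + 1) / F y \<le> f x powr (p + 1) / F x"
        using F_ratio[of x y] F_pos[of x] F_pos[of y] by (simp add: field_simps)
      \<comment> \<open>The nonpositive exponent turns the decreasing ratio into an increasing
        weight.\<close>
      then show "\<tau> x \<le> \<tau> y"
        unfolding \<tau>_def using be F_pos[of y] f_pos[of y] xy by (intro powr_mono2') auto
    qed
    fix x assume x: "x \<in> {a<..<b}"
    show "\<rho> x * \<tau> x = f x powr r"
      using F_pos[of x] f_pos[OF x] x by (simp add: \<rho>_def \<tau>_def powr_divide powr_powr powr_diff beta_mult)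
    show "0 \<le> \<rho> x" "0 \<le> \<tau> x" using f_nonneg by (auto simp: \<rho>_def \<tau>_def)
  qed
qed

text \<open>In terms of \<open>y = F / V\<close> the antiderivative \<open>\<Phi>\<close> is a multiple of \<open>(y powr (\<theta> + 1) - y) * (1 - y) powr \<beta>\<close>,
  which vanishes at both ends.\<close>
lemma F_powr_mean_ge_large:
  assumes r: "1 < r"
  shows "(p + 1) / (2 * p + r) * V powr \<theta> * integral {a..b} (\<lambda>t. f t powr r)
    \<le> integral {a..b} (\<lambda>t. F t powr \<theta> * f t powr r)"
proof -
  define \<beta> where "\<beta> = (r - 1) / (p + 1)"
  define c where "c = (p + 1) / (2 * p + r)"
  have be: "0 < \<beta>" using r p by (simp add: \<beta>_def)
  note th = \<theta>_pos
  have beta_mult: "(p + 1) * \<beta> = r - 1" using p by (simp add: \<beta>_def)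
  have ceq: "c = 1 / (1 + \<theta> + \<beta>)"
  proof -
    have "(p + 1) * (1 + \<theta> + \<beta>) = 2 * p + r"
      unfolding distrib_left[of "p + 1"] beta_mult \<theta>_mult by simp
    moreover have "1 / (1 + \<theta> + \<beta>) = ((p + 1) * 1) / ((p + 1) * (1 + \<theta> + \<beta>))"
      using p by (intro mult_divide_mult_cancel_left[symmetric]) simp
    ultimately show ?thesis unfolding c_def by simp
  qed
  define \<Phi> where "\<Phi> = (\<lambda>x. c * ((F x powr (\<theta> + 1) - V powr \<theta> * F x) * (V - F x) powr \<beta>))"
  define \<psi> where "\<psi> = (\<lambda>x. c * (((\<theta> + 1) * F x powr \<theta> - V powr \<theta>) * f x * (V - F x) powr \<beta>
     - (F x powr (\<theta> + 1) - V powr \<theta> * F x) * (\<beta> * (V - F x) powr (\<beta> - 1) * f x)))"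
  define \<rho> where "\<rho> = (\<lambda>x. f x * (V - F x) powr \<beta>)"
  define \<tau> where "\<tau> = (\<lambda>x. (f x powr (p + 1) / (V - F x)) powr \<beta>)"
  have "(\<psi> has_integral \<Phi> b - \<Phi> a) {a..b}"
  \<comment> \<open>The exponent \<open>\<beta> - 1\<close> in \<open>\<psi>\<close> may be
    negative, so differentiability is used only in the interior, while \<open>\<beta> > 0\<close>
    makes \<open>\<Phi>\<close> continuous at \<open>b\<close>.\<close>
  proof (rule fundamental_theorem_of_calculus_interior)
    show "continuous_on {a..b} \<Phi>"
      unfolding \<Phi>_def using be th F_bounds by (intro continuous_intros continuous_on_powr' continuous_F) auto
    fix x assume x: "x \<in> {a<..<b}"
    have "(\<Phi> has_real_derivative \<psi> x) (at x)"
      unfolding \<Phi>_def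
      by (rule DERIV_cong[OF DERIV_cmult[OF DERIV_mult[OF DERIV_diff[OF F_powr_derivative[OF x]
            DERIV_cmult[OF F_derivative[OF x]]] complement_powr_derivative[OF x]]]])
        (simp add: \<psi>_def algebra_simps)
    then show "(\<Phi> has_vector_derivative \<psi> x) (at x)"
      by (simp add: has_real_derivative_iff_has_vector_derivative)
  qed (use ab in simp)
  moreover have "\<Phi> b - \<Phi> a = 0"
    by (simp add: \<Phi>_def V_def)
  ultimately have psi: "(\<psi> has_integral 0) {a..b}" by simp
  show ?thesis unfolding c_def[symmetric]
  proof (rule F_powr_deviation_nonneg[OF _ _ _ psi, of r c \<rho> \<tau>])
    show "0 \<le> r" "0 < c" "c < 1" using r be th by (simp_all add: ceq)
    show "mono_on {a<..<b} \<tau>"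
    proof (rule mono_onI)
      fix x y assume xy: "x \<in> {a<..<b}" "y \<in> {a<..<b}" "x \<le> y"
      then have "f x powr (p + 1) / (V - F x) \<le> f y powr (p + 1) / (V - F y)"
        using complement_ratio[of x y] F_less_V[of x] F_less_V[of y] by (simp add: field_simps)
      then show "\<tau> x \<le> \<tau> y"
        unfolding \<tau>_def using be F_less_V[of x] xy by (intro powr_mono2) auto
    qed
    fix x assume x: "x \<in> {a<..<b}"
    have FV: "0 < F x" "F x < V" using F_pos[of x] F_less_V[of x] x by auto
    show "\<rho> x * \<tau> x = f x powr r"
      using FV f_pos[OF x] by (simp add: \<rho>_def \<tau>_def powr_divide powr_powr powr_diff beta_mult)
    show "0 \<le> \<rho> x" "0 \<le> \<tau> x" using f_nonneg by (auto simp: \<rho>_def \<tau>_def)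
    have key: "V powr \<theta> * F x \<le> F x powr \<theta> * V"
    proof -
      have "(F x / V) powr 1 \<le> (F x / V) powr \<theta>"
        using FV \<theta>_le_1 by (intro powr_mono') auto
      then show ?thesis using FV by (simp add: powr_divide field_simps)
    qed
    \<comment> \<open>Splitting off one factor \<open>V - F x\<close> leaves the common nonnegative
      factor \<open>g\<close> in all terms of \<open>\<psi>\<close> and
      \<open>\<rho>\<close>.\<close>
    have pb: "(V - F x) powr \<beta> = (V - F x) * (V - F x) powr (\<beta> - 1)"
      using FV by (simp add: powr_diff)
    define g where "g = f x * (V - F x) powr (\<beta> - 1)"
    have g: "0 \<le> g" using f_nonneg by (simp add: g_def)
    have "c * \<beta> * g * (V powr \<theta> * F x - F x powr \<theta> * F x) \<le> c * \<beta> * g * (F x powr \<theta> * (V - F x))"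
      using key g be th by (intro mult_left_mono) (auto simp: ceq algebra_simps)
    moreover have "\<psi> x = c * ((\<theta> + 1) * F x powr \<theta> - V powr \<theta>) * (V - F x) * g
        + c * \<beta> * g * (V powr \<theta> * F x - F x powr \<theta> * F x)"
      unfolding \<psi>_def pb g_def using FV by (simp add: powr_add algebra_simps)
    \<comment> \<open>After \<open>key\<close> every term contains \<open>V - F x\<close>, and the
      coefficient of \<open>F x powr \<theta>\<close> becomes
      \<open>c * (1 + \<theta> + \<beta>)\<close>; the choice of \<open>c\<close> makes it
      1.\<close>
    moreover have "c * ((\<theta> + 1) * F x powr \<theta> - V powr \<theta>) * (V - F x) * g + c * \<beta> * g * (F x powr \<theta> * (V - F x))
       = (c * (1 + \<theta> + \<beta>) * F x powr \<theta> - c * V powr \<theta>) * ((V - F x) * g)"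
      by (simp add: algebra_simps)
    moreover have "c * (1 + \<theta> + \<beta>) = 1" using be th by (simp add: ceq)
    moreover have "\<rho> x = (V - F x) * g" by (simp add: \<rho>_def pb g_def)
    ultimately show "\<psi> x \<le> (F x powr \<theta> - c * V powr \<theta>) * \<rho> x" by simp
  qed
qed

section \<open>The bound on the mass fraction\<close>

lemma integral_powr_pos:
  assumes "0 \<le> r"
  shows "0 < integral {a..b} (\<lambda>t. f t powr r)"
proof (intro integral_pos_of_interior_pos ab)
  show "(\<lambda>t. f t powr r) integrable_on {a..b}"
    using integrable_continuous_mult_powr[of a b "\<lambda>_. 1" r] assms by simp
  show "continuous_on {a<..<b} (\<lambda>t. f t powr r)"
    by (intro continuous_intros continuous_f) (use f_pos in force)
qed (use f_pos in force)

text \<open>Otherwise \<open>t * f t powr r\<close> would have a strict constant sign on the open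
  interval. This places the tangent point of the Jensen step inside the domain of concavity.\<close>

lemma zero_in_interior:
  assumes r: "0 \<le> r" and mean: "integral {a..b} (\<lambda>t. t * f t powr r) = 0"
  shows "0 \<in> {a<..<b}"
proof (rule ccontr)
  have i2: "(\<lambda>t. t * f t powr r) integrable_on {a..b}"
    using r by (intro integrable_continuous_mult_powr continuous_intros)
  have cont: "continuous_on {a<..<b} (\<lambda>t. t * f t powr r)"
    by (intro continuous_intros continuous_f) (use f_pos in force)
  assume "0 \<notin> {a<..<b}"
  then consider "0 \<le> a" | "b \<le> 0" by fastforce
  then show False
  proof cases
    case 1
    then have "0 < integral {a..b} (\<lambda>t. t * f t powr r)"
      using f_pos by (intro integral_pos_of_interior_pos ab i2 cont) (force intro!: mult_pos_pos)
    then show False using mean by simp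
  next
    case 2
    have "0 < integral {a..b} (\<lambda>t. - (t * f t powr r))"
    proof (intro integral_pos_of_interior_pos ab integrable_neg i2 continuous_on_minus cont)
      fix x assume "x \<in> {a<..<b}"
      then show "0 < - (x * f x powr r)" using 2 f_pos[of x] by (simp add: mult_neg_pos)
    qed
    then show False using mean by simp
  qed
qed

text \<open>Upper and lower bounds on the mean combine to
  \<open>c * V powr \<theta> \<le> F 0 powr \<theta>\<close>; raising to the power
  \<open>1 / \<theta> = (p + 1) / p\<close> gives the claim.\<close>

theorem mass_fraction_ge:
  assumes r: "0 \<le> r" and mean: "integral {a..b} (\<lambda>t. t * f t powr r) = 0"
  shows "1 \<le> r \<Longrightarrow> ((p + 1) / (2 * p + r)) powr ((p + 1) / p) \<le> F 0 / V"
    and "r \<le> 1 \<Longrightarrow> ((p + r) / (2 * p + r)) powr ((p + 1) / p) \<le> F 0 / V"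
proof -
  have 0: "0 \<in> {a<..<b}" using zero_in_interior[OF assms] .
  note I = integral_powr_pos[OF r]
  have concl: "c powr ((p + 1) / p) \<le> F 0 / V"
    if "c * V powr \<theta> * integral {a..b} (\<lambda>t. f t powr r) \<le> integral {a..b} (\<lambda>t. F t powr \<theta> * f t powr r)"
      and c: "0 \<le> c" for c
  proof -
    have "c * V powr \<theta> * integral {a..b} (\<lambda>t. f t powr r) \<le> F 0 powr \<theta> * integral {a..b} (\<lambda>t. f t powr r)"
      using that(1) F_powr_mean_le[OF r mean 0] by linarith
    then have "c * V powr \<theta> \<le> F 0 powr \<theta>" using I by simp
    moreover have FV: "0 < F 0" "0 < V" using F_pos[of 0] 0 V_pos by auto
    ultimately have "c \<le> (F 0 / V) powr \<theta>" by (simp add: powr_divide field_simps)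
    then have "c powr ((p + 1) / p) \<le> ((F 0 / V) powr \<theta>) powr ((p + 1) / p)"
      using c p by (intro powr_mono2) auto
    also have "\<dots> = F 0 / V" using FV p by (simp add: powr_powr \<theta>_def)
    finally show ?thesis .
  qed
  show small: "((p + r) / (2 * p + r)) powr ((p + 1) / p) \<le> F 0 / V" if "r \<le> 1"
    using F_powr_mean_ge_small[OF r that] r p by (intro concl) auto
  show "((p + 1) / (2 * p + r)) powr ((p + 1) / p) \<le> F 0 / V" if "1 \<le> r"
  \<comment> \<open>At \<open>r = 1\<close> the two constants agree, so this value is taken from the
    case \<open>r \<le> 1\<close>; the other estimate relies on \<open>\<beta> > 0\<close>.\<close>
  proof (cases "r = 1")
    case True
    then show ?thesis using small by (simp add: add.commute)
  next
    case False
    then show ?thesis using F_powr_mean_ge_large that p by (intro concl) auto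
  qed
qed

end

section \<open>The section function\<close>

text \<open>The lower bound in \<open>p_concave\<close> is positive, so the support is convex; this
  makes the section function positive strictly between \<open>supp_lo\<close> and
  \<open>supp_hi\<close>.\<close>

lemma p_concave_interval_pos:
  assumes "p_concave \<phi> p" "0 < p" "0 < \<phi> s" "0 < \<phi> t" "s < x" "x < t"
  shows "0 < \<phi> x"
proof -
  define l where "l = (x - s) / (t - s)"
  have l: "0 < l" "l < 1" "l * (t - s) = x - s" using assms by (auto simp: l_def)
  have "0 < (1 - l) * \<phi> s powr p + l * \<phi> t powr p"
    using l assms by (intro add_pos_pos mult_pos_pos) auto
  then have "0 < ((1 - l) * \<phi> s powr p + l * \<phi> t powr p) powr (1 / p)" by simp
  also have "\<dots> \<le> \<phi> ((1 - l) * s + l * t)"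
    using assms l unfolding p_concave_def by simp
  also have "(1 - l) * s + l * t = x" using l(3) by (simp add: algebra_simps)
  finally show ?thesis .
qed

lemma p_concave_imp_concave_on:
  assumes "p_concave \<phi> p" "0 < p" and pos: "\<And>x. x \<in> {a<..<b} \<Longrightarrow> 0 < \<phi> x"
  shows "concave_on {a<..<b} (\<lambda>x. \<phi> x powr p)"
  unfolding concave_on_def
proof (rule convex_onI)
  fix l x y :: real
  assume l: "0 < l" "l < 1" and xy: "x \<in> {a<..<b}" "y \<in> {a<..<b}"
  define z where "z = (1 - l) * \<phi> x powr p + l * \<phi> y powr p"
  have z: "0 \<le> z" using l by (simp add: z_def)
  have "z powr (1 / p) \<le> \<phi> ((1 - l) * x + l * y)"
    using assms(1) l pos[OF xy(1)] pos[OF xy(2)] unfolding p_concave_def z_def by simp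
  then have "(z powr (1 / p)) powr p \<le> \<phi> ((1 - l) * x + l * y) powr p"
    using assms(2) by (intro powr_mono2) auto
  then have "z \<le> \<phi> ((1 - l) * x + l * y) powr p"
    using z assms(2) by (simp add: powr_powr)
  then show "- (\<phi> ((1 - l) *\<^sub>R x + l *\<^sub>R y) powr p) \<le> (1 - l) * - (\<phi> x powr p) + l * - (\<phi> y powr p)"
    by (simp add: z_def)
qed simp

text \<open>Otherwise the section function vanishes off a single point, and by Fubini
  \<open>K\<close> is a null set, which its interior forbids. This ensures that the support is a
  nondegenerate interval.\<close>

lemma section_vol_two_points:
  fixes K :: "'a::euclidean_space set"
  assumes u: "norm u = 1" and K: "compact K" and "interior K \<noteq> {}"
  obtains s t where "s < t" "0 < section_vol K u s" "0 < section_vol K u t"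
proof (rule ccontr)
  let ?f = "section_vol K u"
  assume "\<not> thesis"
  then have no: "\<And>s t. s < t \<Longrightarrow> 0 < ?f s \<Longrightarrow> 0 < ?f t \<Longrightarrow> False" using that by blast
  obtain c where c: "\<And>t. t \<noteq> c \<Longrightarrow> ?f t = 0"
  proof (cases "\<exists>c. 0 < ?f c")
    case True
    then obtain c where "0 < ?f c" by blast
    then have "?f t = 0" if "t \<noteq> c" for t
      using no[of t c] no[of c t] that measure_nonneg
      by (metis linorder_neqE order_less_le section_vol_def)
    then show ?thesis using that by blast
  next
    case False
    then have "?f t = 0" for t by (metis measure_nonneg order_less_le section_vol_def)
    then show ?thesis using that by blast
  qed
  have "(?f has_integral 0) UNIV"
    by (rule has_integral_spike_finite[of "{c}" _ ?f "\<lambda>_. 0"]) (use c in auto)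
  moreover have "(?f has_integral measure lebesgue K) UNIV"
    using has_integral_section_vol[OF u K, of UNIV] by simp
  ultimately have "measure lebesgue K = 0" using has_integral_unique by blast
  then have "negligible K"
    using K by (simp add: negligible_iff_measure0 lmeasurable_compact)
  then have "negligible (interior K)"
    using interior_subset negligible_subset by blast
  then show False using assms(3) open_not_negligible[OF open_interior] by blast
qed

text \<open>Boundedness of \<open>K\<close> bounds the set of heights with positive section, so its
  \<open>Inf\<close> and \<open>Sup\<close> are genuine ends; every point strictly between them lies
  between two heights of positive section.\<close>

lemma section_vol_profile:
  fixes K :: "'a::euclidean_space set"
  assumes p: "0 < p" and u: "norm u = 1" and K: "compact K" "interior K \<noteq> {}"
    and conc: "p_concave (section_vol K u) p"
  obtains M where
    "concave_power_profile (section_vol K u) (supp_lo (section_vol K u)) (supp_hi (section_vol K u)) p M"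
    and "\<And>t. t \<notin> {supp_lo (section_vol K u)..supp_hi (section_vol K u)} \<Longrightarrow> section_vol K u t = 0"
proof -
  let ?f = "section_vol K u"
  define S where "S = {t. 0 < ?f t}"
  obtain R where R: "\<And>x. x \<in> K \<Longrightarrow> norm x \<le> R"
    using compact_imp_bounded[OF K(1)] by (auto simp: bounded_iff)
  have S: "\<bar>t\<bar> \<le> R" if t: "t \<in> S" for t
  proof -
    obtain x where x: "x \<in> K" "x \<bullet> u = t"
      using section_vol_support[of K u t] t by (auto simp: S_def)
    then show ?thesis using Cauchy_Schwarz_ineq2[of x u] R[of x] u by simp
  qed
  have "- R \<le> t" "t \<le> R" if "t \<in> S" for t
    using S[OF that] by auto
  then have bdd: "bdd_below S" "bdd_above S" by - (rule bdd_belowI, assumption, rule bdd_aboveI, assumption)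
  obtain s t where st: "s < t" "s \<in> S" "t \<in> S"
    using section_vol_two_points[OF u K] by (auto simp: S_def)
  have lo: "supp_lo ?f = Inf S" and hi: "supp_hi ?f = Sup S"
    by (simp_all add: supp_lo_def supp_hi_def S_def)
  have nonneg: "0 \<le> ?f x" for x by (simp add: section_vol_def)
  have pos: "0 < ?f x" if x: "x \<in> {Inf S<..<Sup S}" for x
  proof -
    obtain y where "y \<in> S" "y < x" using x cInf_lessD[of S x] st by auto
    moreover obtain z where "z \<in> S" "x < z" using x less_cSupD[of S x] st by auto
    ultimately show ?thesis
      using p_concave_interval_pos[OF conc p, of y z x] by (auto simp: S_def)
  qed
  obtain M where M: "\<And>t. ?f t \<le> M" using section_vol_bounded[OF u K(1)] by blast
  show ?thesis
  proof
    show "concave_power_profile ?f (supp_lo ?f) (supp_hi ?f) p M"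
      unfolding lo hi
    proof
      show "Inf S < Sup S"
        using st cInf_lower[OF st(2) bdd(1)] cSup_upper[OF st(3) bdd(2)] by linarith
      show "concave_on {Inf S<..<Sup S} (\<lambda>x. ?f x powr p)"
        using conc p pos by (rule p_concave_imp_concave_on)
    qed (use p section_vol_measurable[OF u K(1)] nonneg M pos in auto)
    show "?f t = 0" if "t \<notin> {supp_lo ?f..supp_hi ?f}" for t
    proof (rule ccontr)
      assume "?f t \<noteq> 0"
      then have "t \<in> S" using nonneg[of t] by (simp add: S_def)
      then show False
        using that cInf_lower[OF _ bdd(1)] cSup_upper[OF _ bdd(2)] by (auto simp: lo hi)
    qed
  qed
qed

section \<open>From the profile back to the body\<close>

theorem theorem1p1:
  fixes K :: "'a::euclidean_space set" and u :: 'a and r p :: real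
  assumes "r \<ge> 0" and "p > 0" and "norm u = 1"
    and "compact K" and "interior K \<noteq> {}"
    and "p_concave (section_vol K u) p"
    and "powered_centroid (section_vol K u) r = 0"
  shows "(r \<ge> 1 \<longrightarrow>
           measure lebesgue (K \<inter> {x. x \<bullet> u \<le> 0}) / measure lebesgue K
             \<ge> ((p + 1) / (2 * p + r)) powr ((p + 1) / p))
       \<and> (r \<le> 1 \<longrightarrow>
           measure lebesgue (K \<inter> {x. x \<bullet> u \<le> 0}) / measure lebesgue K
             \<ge> ((p + r) / (2 * p + r)) powr ((p + 1) / p))"
proof -
  let ?f = "section_vol K u"
  define a b where "a = supp_lo ?f" and "b = supp_hi ?f"
  obtain M where prof: "concave_power_profile ?f a b p M"
    and out: "\<And>t. t \<notin> {a..b} \<Longrightarrow> ?f t = 0"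
    using section_vol_profile[OF assms(2-6)] unfolding a_def b_def by blast
  interpret concave_power_profile ?f a b p M by (rule prof)
  have mean: "integral {a..b} (\<lambda>t. t * ?f t powr r) = 0"
  proof (cases "r = 0")
    case True
    then have "a + b = 0" using assms(7) by (simp add: powered_centroid_def a_def b_def)
    then have "a = - b" by linarith
    have "((\<lambda>t. t) has_integral (b\<^sup>2 / 2 - a\<^sup>2 / 2)) {a..b}"
    proof (rule fundamental_theorem_of_calculus)
      fix x assume "x \<in> {a..b}"
      have "((\<lambda>x. x\<^sup>2 / 2) has_real_derivative x) (at x within {a..b})"
        by (auto intro!: derivative_eq_intros)
      then show "((\<lambda>x. x\<^sup>2 / 2) has_vector_derivative x) (at x within {a..b})"
        by (simp add: has_real_derivative_iff_has_vector_derivative)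
    qed (use ab in simp)
    moreover have "b\<^sup>2 / 2 - a\<^sup>2 / 2 = 0"
      by (simp only: \<open>a = - b\<close> power2_minus diff_self)
    \<comment> \<open>For \<open>r = 0\<close> the factor \<open>?f t powr r\<close> is 1 where
      \<open>?f\<close> is positive and 0 where it vanishes (\<open>0 powr 0 = 0\<close>), which
      inside \<open>{a..b}\<close> can occur only at the two ends.\<close>
    moreover have "integral {a..b} (\<lambda>t. t * ?f t powr r) = integral {a..b} (\<lambda>t. t)"
    proof (rule integral_spike[of "{a, b}"])
      fix x assume "x \<in> {a..b} - {a, b}"
      then have "0 < ?f x" by (intro f_pos) auto
      then show "x = x * ?f x powr r" using True by simp
    qed simp
    ultimately show ?thesis by (simp add: integral_unique)
  next
    case False
    \<comment> \<open>The factor \<open>1\<close> brings the denominator into the form of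
      \<open>set_lebesgue_integral_mult_powr\<close>. As the denominator is positive, the vanishing
      quotient forces a vanishing numerator.\<close>
    then have "(LINT t:{a..b}|lborel. t * ?f t powr r) / (LINT t:{a..b}|lborel. 1 * ?f t powr r) = 0"
      using assms(7) by (simp add: powered_centroid_def a_def b_def)
    then show ?thesis
      using integral_powr_pos[OF assms(1)] assms(1)
      by (subst (asm) (1 2) set_lebesgue_integral_mult_powr) (auto intro!: continuous_intros)
  qed
  \<comment> \<open>Used with \<open>{..0}\<close> for the cut part and with \<open>UNIV\<close> for
    the whole body; outside \<open>{a..b}\<close> the sections contribute nothing.\<close>
  have restrict: "measure lebesgue (K \<inter> {x. x \<bullet> u \<in> T}) = integral {a..c} ?f"
    if T: "T \<in> sets borel" and eq: "\<And>t. t \<in> {a..b} \<Longrightarrow> t \<in> T \<longleftrightarrow> t \<le> c" and c: "c \<le> b" for T c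
  proof -
    have *: "(\<lambda>t. if t \<in> T then ?f t else 0) = (\<lambda>t. if t \<in> {a..c} then ?f t else 0)"
      using out eq c by (intro ext) (smt (verit, ccfv_threshold) atLeastAtMost_iff)
    have "((\<lambda>t. if t \<in> T then ?f t else 0) has_integral measure lebesgue (K \<inter> {x. x \<bullet> u \<in> T})) UNIV"
      using has_integral_section_vol[OF assms(3,4) T] by (simp only: has_integral_restrict_UNIV)
    then have "(?f has_integral measure lebesgue (K \<inter> {x. x \<bullet> u \<in> T})) {a..c}"
      by (simp only: * has_integral_restrict_UNIV)
    then show ?thesis by (simp add: integral_unique)
  qed
  have "measure lebesgue (K \<inter> {x. x \<bullet> u \<le> 0}) = F 0"
    using restrict[of "{..0}" 0] zero_in_interior[OF assms(1) mean] by (simp add: F_def)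
  moreover have "measure lebesgue K = V"
    using restrict[of UNIV b] by (simp add: F_def V_def)
  ultimately show ?thesis
    using mass_fraction_ge[OF assms(1) mean] by simp
qed

end
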